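(* Let $a>0$ and $\alpha\in[0,1]$. Let $Y\sim G$ be a random variable with values in $\mathbb{R}_+=[0,\infty)$ having finite moments of all positive integer orders, and let $G$ be absolutely continuous on $\mathbb{R}_{+,x_0}=[x_0,\infty)$ for some $x_0>\mathrm{e}$ with density $G'(x)=g(x)>0$ on $\mathbb{R}_{+,x_0}$. If $$\limsup_{x\to\infty}\frac{g\left(x+a(\log x)^{\alpha}/\log\log x\right)}{g(x)}<1,$$ then both $Y$ and $Y^2$ are M-det on $\mathbb{R}_+$.
   Context: $Y\sim G$ means that the random variable $Y$ has distribution (function) $G$. The distribution $G$ is arbitrary on $[0,x_0)$; only its restriction to $[x_0,\infty)$ is assumed absolutely continuous. M-determinacy: a random variable with values in $\mathbb{R}_+$ and finite moments of all orders is M-det (moment-determinate) on $\mathbb{R}_+$ if no probability distribution on $\mathbb{R}_+$ other than its own has the same moment sequence (moments of all orders $n\in\mathbb{N}=\{1,2,\ldots\}$). *)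

theory Defs
  imports "HOL-Probability.Probability"
begin

(* The distribution function G is absolutely continuous on [x0, \<infinity>) with
   Lebesgue density g, in the integrated (Lebesgue fundamental theorem) form;
   nothing is required of G below x0.  Local integrability is stated explicitly
   because the Bochner integral of a non-integrable function is 0 by convention. *)
definition abs_cont_from_with_density ::
    "(real \<Rightarrow> real) \<Rightarrow> real \<Rightarrow> (real \<Rightarrow> real) \<Rightarrow> bool" where
  "abs_cont_from_with_density G x0 g \<longleftrightarrow>
     (\<forall>x\<ge>x0. set_integrable lborel {x0..x} g \<and>
              G x - G x0 = (LINT t:{x0..x}|lborel. g t))"

definition nonneg_dist_finite_moments :: "real measure \<Rightarrow> bool" where
  "nonneg_dist_finite_moments \<mu> \<longleftrightarrow>
     real_distribution \<mu> \<and> (AE x in \<mu>. 0 \<le> x) \<and> (\<forall>n\<ge>1. integrable \<mu> (\<lambda>x. x ^ n))"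

definition M_det_dist :: "real measure \<Rightarrow> bool" where
  "M_det_dist \<mu> \<longleftrightarrow>
     nonneg_dist_finite_moments \<mu> \<and>
     (\<forall>\<nu>. nonneg_dist_finite_moments \<nu> \<and>
          (\<forall>n\<ge>1. (LINT x|\<nu>. x ^ n) = (LINT x|\<mu>. x ^ n)) \<longrightarrow> \<nu> = \<mu>)"

definition M_det :: "'a measure \<Rightarrow> ('a \<Rightarrow> real) \<Rightarrow> bool" where
  "M_det M X \<longleftrightarrow> M_det_dist (distr M borel X)"

end

theory Submission
  imports Defs
begin

text \<open>
The hypothesis says that, far out, a step of length \<open>s(x) \<le> a ln x\<close> multiplies the density by a factor
\<open>q < 1\<close>. Substituting \<open>T x = x + s(x)\<close>, whose derivative tends to one, shows that the integral of
\<open>x\<^sup>k g(x)\<close> beyond \<open>T X\<close> is at most a fixed fraction of the integral beyond \<open>X\<close>, provided that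
\<open>(T x)\<^sup>k\<close> and \<open>x\<^sup>k\<close> differ only by a factor close to one for \<open>x \<ge> X\<close>. This holds when
\<open>k ln X / X\<close> is small, that is, when \<open>X\<close> is a large multiple of \<open>k ln k\<close>. The part of the moment beyond
\<open>X\<close> is then at most a constant times \<open>X\<^sup>k\<close>, and so the moment of even order \<open>k\<close> of \<open>Y\<close> is at most
\<open>A (C k ln k)\<^sup>k\<close> (\<open>truncated_density_moment_le\<close>, \<open>even_moment_growth\<close>).

Consequently the \<open>n\<close>-th moment of \<open>Y\<^sup>2\<close>, and that of \<open>Y\<close> as well because \<open>y\<^sup>n \<le> y\<^sup>2\<^sup>n + 1\<close>, is at most
\<open>A (\<Prod>i<n. c i)\<^sup>2\<close> with \<open>c i\<close> of order \<open>i ln i\<close>. As \<open>\<Sum> 1 / c i\<close> diverges, this is Carleman's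
condition for determinacy on the half-line.

Carleman's criterion (\<open>carleman_stieltjes\<close>) is proved by passing from a law on the half-line to the law
of \<open>\<plusminus>\<surd>X\<close> with a random sign, which reduces it to the criterion on the whole line
(\<open>carleman_hamburger\<close>). There, the characteristic functions of two laws with equal moments have
a difference that is flat at the origin and whose derivatives are bounded by a sequence in a
quasi-analytic Denjoy--Carleman class. Such a function vanishes, by Bang's elementary argument
(\<open>bang_quasianalytic\<close>), and the characteristic function determines the law.
\<close>

section \<open>Quasi-analyticity after Bang\<close>

lemma exp_partial_sum_le:
  fixes x :: real
  assumes "0 \<le> x"
  shows "(\<Sum>i\<le>n. x ^ i / fact i) \<le> exp x"
proof -
  have "(\<Sum>i\<le>n. x ^ i /\<^sub>R fact i) \<le> (\<Sum>i. x ^ i /\<^sub>R fact i)"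
    using assms by (intro sum_le_suminf summable_exp_generic) auto
  then show ?thesis
    by (simp add: exp_def divide_inverse mult.commute)
qed

text \<open>
This is the only way in which logarithmic convexity of \<open>M\<close> (monotonicity of its successive ratios
\<open>\<mu>\<close>) enters Bang's argument.
\<close>

lemma prod_ratio_bound:
  fixes M \<mu> :: "nat \<Rightarrow> real"
  assumes M0: "\<And>n. 0 \<le> M n" and \<mu>0: "\<And>n. 0 \<le> \<mu> n" and mono: "mono \<mu>"
    and ratio: "\<And>n. M (Suc n) = \<mu> n * M n"
    and "j + i \<le> Suc K"
  shows "M (j + i) \<le> \<mu> K ^ i * M j"
  using \<open>j + i \<le> Suc K\<close>
proof (induction i)
  case (Suc i)
  have "M (j + Suc i) = \<mu> (j + i) * M (j + i)" by (simp add: ratio)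
  also have "\<dots> \<le> \<mu> K * (\<mu> K ^ i * M j)"
    using Suc by (intro mult_mono) (auto simp: M0 \<mu>0 intro: monoD[OF mono])
  finally show ?case by simp
qed simp

text \<open>
The family \<open>F j\<close> stands for the successive derivatives of one function, up to factors of modulus
one; only the Taylor estimates between them matter. The quantity to follow is Bang's degree
\<open>B(x) = sup\<^sub>j |F j x| / (e\<^sup>j M j)\<close>, here written out as a family of bounds. Expanding up to order
\<open>N = K + 1\<close> turns a bound \<open>B(x) \<le> e\<^sup>-\<^sup>N\<close> into \<open>B(x + h) \<le> e\<^sup>-\<^sup>N exp(e h \<mu> K)\<close>: the remainder fits as the
last term of the exponential series, and orders \<open>j \<ge> N\<close> cost nothing because there the weight
\<open>e\<^sup>-\<^sup>j\<close> is already below \<open>e\<^sup>-\<^sup>N\<close>. Thus \<open>B\<close> needs an interval of length at least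
\<open>1 / (e \<mu> K)\<close> to climb from \<open>e\<^sup>-\<^sup>(\<^sup>K\<^sup>+\<^sup>1\<^sup>)\<close> beyond \<open>e\<^sup>-\<^sup>K\<close>.
\<close>

lemma bang_step:
  fixes F :: "nat \<Rightarrow> real \<Rightarrow> complex" and M \<mu> :: "nat \<Rightarrow> real"
  assumes M0: "\<And>n. 0 \<le> M n" and \<mu>0: "\<And>n. 0 < \<mu> n" and mono: "mono \<mu>"
    and ratio: "\<And>n. M (Suc n) = \<mu> n * M n"
    and bound: "\<And>j x. norm (F j x) \<le> M j"
    and taylor: "\<And>j N x h. \<lbrakk>j < N; 0 \<le> h\<rbrakk> \<Longrightarrow> norm (F j (x + h)) \<le>
          (\<Sum>i<N - j. norm (F (j + i) x) * (h ^ i / fact i)) + M N * (h ^ (N - j) / fact (N - j))"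
    and flat: "\<And>j. norm (F j x) \<le> exp (real j - real (Suc K)) * M j"
    and h: "0 \<le> h" "h * exp 1 * \<mu> K \<le> 1"
  shows "norm (F j (x + h)) \<le> exp (real j - real K) * M j"
proof (cases "j < Suc K")
  case False
  then have "1 \<le> exp (real j - real K)" by simp
  then have "1 * M j \<le> exp (real j - real K) * M j" by (intro mult_right_mono M0)
  with bound[of j "x + h"] show ?thesis by simp
next
  case True
  let ?N = "Suc K"
  have term_le: "exp (real (j + i) - real ?N) * M (j + i) * (h ^ i / fact i)
      \<le> exp (real j - real ?N) * M j * ((h * exp 1 * \<mu> K) ^ i / fact i)" if "i \<le> ?N - j" for i
  proof -
    have "exp (real (j + i) - real ?N) = exp (real j - real ?N) * exp 1 ^ i"
      by (simp add: exp_diff exp_add exp_of_nat_mult[symmetric])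
    moreover have "M (j + i) \<le> \<mu> K ^ i * M j"
      using that True by (intro prod_ratio_bound[OF M0 _ mono ratio] less_imp_le[OF \<mu>0]) simp
    then have "exp (real j - real ?N) * exp 1 ^ i * M (j + i) * (h ^ i / fact i)
        \<le> exp (real j - real ?N) * exp 1 ^ i * (\<mu> K ^ i * M j) * (h ^ i / fact i)"
      using h by (intro mult_right_mono mult_left_mono) auto
    ultimately show ?thesis
      by (simp add: power_mult_distrib mult_ac)
  qed
  have "norm (F j (x + h)) \<le>
      (\<Sum>i<?N - j. norm (F (j + i) x) * (h ^ i / fact i)) + M ?N * (h ^ (?N - j) / fact (?N - j))"
    using True h by (intro taylor)
  \<comment> \<open>The remainder carries the factor \<open>exp 0\<close>, so it has exactly the shape of the missing term \<open>i = N - j\<close>.\<close>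
  also have "\<dots> \<le> (\<Sum>i<?N - j. exp (real (j + i) - real ?N) * M (j + i) * (h ^ i / fact i))
      + exp (real (j + (?N - j)) - real ?N) * M (j + (?N - j)) * (h ^ (?N - j) / fact (?N - j))"
    using True h by (intro add_mono sum_mono mult_right_mono flat) auto
  also have "\<dots> = (\<Sum>i\<le>?N - j. exp (real (j + i) - real ?N) * M (j + i) * (h ^ i / fact i))"
    by (simp add: lessThan_Suc_atMost[symmetric])
  also have "\<dots> \<le> (\<Sum>i\<le>?N - j. exp (real j - real ?N) * M j * ((h * exp 1 * \<mu> K) ^ i / fact i))"
    by (intro sum_mono term_le) simp
  also have "\<dots> = exp (real j - real ?N) * M j * (\<Sum>i\<le>?N - j. (h * exp 1 * \<mu> K) ^ i / fact i)"
    by (simp add: sum_distrib_left)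
  also have "\<dots> \<le> exp (real j - real ?N) * M j * exp 1"
  proof (intro mult_left_mono)
    have "0 \<le> h * exp 1 * \<mu> K" using h \<mu>0[of K] by simp
    then have "(\<Sum>i\<le>?N - j. (h * exp 1 * \<mu> K) ^ i / fact i) \<le> exp (h * exp 1 * \<mu> K)"
      by (rule exp_partial_sum_le)
    also have "\<dots> \<le> exp 1" using h by simp
    finally show "(\<Sum>i\<le>?N - j. (h * exp 1 * \<mu> K) ^ i / fact i) \<le> exp 1" .
  qed (simp add: M0)
  also have "\<dots> = exp (real j - real K) * M j"
    by (simp add: exp_diff exp_add)
  finally show ?thesis .
qed

text \<open>
To climb from the level \<open>e\<^sup>-\<^sup>(\<^sup>K\<^sup>+\<^sup>n\<^sup>)\<close>, which is available at the origin for every \<open>n\<close>, to the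
level \<open>e\<^sup>-\<^sup>K\<close>, the degree must spend at least \<open>1 / (e \<mu> i)\<close> on each level in between. The induction
peels off the last of these intervals.
\<close>

lemma bang_flatness_propagates:
  fixes F :: "nat \<Rightarrow> real \<Rightarrow> complex" and M \<mu> :: "nat \<Rightarrow> real"
  assumes M0: "\<And>n. 0 \<le> M n" and \<mu>0: "\<And>n. 0 < \<mu> n" and mono: "mono \<mu>"
    and ratio: "\<And>n. M (Suc n) = \<mu> n * M n"
    and bound: "\<And>j x. norm (F j x) \<le> M j"
    and taylor: "\<And>j N x h. \<lbrakk>j < N; 0 \<le> h\<rbrakk> \<Longrightarrow> norm (F j (x + h)) \<le>
          (\<Sum>i<N - j. norm (F (j + i) x) * (h ^ i / fact i)) + M N * (h ^ (N - j) / fact (N - j))"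
    and zero: "\<And>j. F j 0 = 0"
    and t: "0 \<le> t" "t * exp 1 \<le> (\<Sum>i\<in>{K..<K + n}. 1 / \<mu> i)"
  shows "norm (F j t) \<le> exp (real j - real K) * M j"
  using t
proof (induction n arbitrary: K t j)
  case 0
  then have "t * exp 1 \<le> 0" by simp
  then have "t = 0" using 0 by (simp add: mult_le_0_iff)
  then show ?case using zero M0 by simp
next
  case (Suc n)
  \<comment> \<open>The length spent between the levels \<open>K + 1\<close> and \<open>K\<close>, cut off at the origin.\<close>
  define h where "h = min t (1 / (exp 1 * \<mu> K))"
  have h: "0 \<le> h" "h \<le> t" using Suc.prems \<mu>0[of K] by (auto simp: h_def)
  have "h \<le> 1 / (exp 1 * \<mu> K)" by (simp add: h_def)
  then have h1: "h * exp 1 * \<mu> K \<le> 1" using \<mu>0[of K] by (simp add: field_simps)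
  have rest: "(t - h) * exp 1 \<le> (\<Sum>i\<in>{Suc K..<Suc K + n}. 1 / \<mu> i)"
  proof (cases "h = t")
    case True
    then show ?thesis by (simp add: sum_nonneg less_imp_le[OF \<mu>0])
  next
    case False
    then have "h = 1 / (exp 1 * \<mu> K)" by (auto simp: h_def min_def)
    then have "h * exp 1 = 1 / \<mu> K" by simp
    moreover have "(\<Sum>i\<in>{K..<K + Suc n}. 1 / \<mu> i) = 1 / \<mu> K + (\<Sum>i\<in>{Suc K..<Suc K + n}. 1 / \<mu> i)"
      by (subst sum.atLeast_Suc_lessThan) auto
    ultimately show ?thesis using Suc.prems by (simp add: algebra_simps)
  qed
  have "norm (F j ((t - h) + h)) \<le> exp (real j - real K) * M j"
    using h h1 rest by (intro bang_step[OF M0 \<mu>0 mono ratio bound taylor] Suc.IH) auto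
  then show ?case by simp
qed

lemma not_summable_block_sums:
  fixes f :: "nat \<Rightarrow> real"
  assumes f: "\<And>n. 0 \<le> f n" and div: "\<not> summable f"
  shows "\<exists>n. B \<le> (\<Sum>i\<in>{K..<K + n}. f i)"
proof (rule ccontr)
  assume "\<not> ?thesis"
  then have "(\<Sum>i\<in>{0 + K..<n + K}. f i) \<le> B" for n
    by (simp add: not_le less_imp_le add.commute[of K])
  then have less: "(\<Sum>i<n. f (i + K)) \<le> B" for n
    by (simp only: sum.shift_bounds_nat_ivl lessThan_atLeast0)
  have "summable (\<lambda>i. f (i + K))"
    using f less by (intro bounded_imp_summable[where B = B]) (metis lessThan_Suc_atMost)+
  with div show False by (simp add: summable_iff_shift)
qed

text \<open>
The quasi-analytic half of the Denjoy--Carleman theorem. Since \<open>\<Sum> 1 / \<mu> i\<close> diverges, a given \<open>t\<close> is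
too close to the origin for the degree to have reached any level \<open>e\<^sup>-\<^sup>K\<close>.
\<close>

theorem bang_quasianalytic:
  fixes F :: "nat \<Rightarrow> real \<Rightarrow> complex" and M \<mu> :: "nat \<Rightarrow> real"
  assumes M0: "\<And>n. 0 \<le> M n" and \<mu>0: "\<And>n. 0 < \<mu> n" and mono: "mono \<mu>"
    and ratio: "\<And>n. M (Suc n) = \<mu> n * M n" and div: "\<not> summable (\<lambda>n. 1 / \<mu> n)"
    and bound: "\<And>j x. norm (F j x) \<le> M j"
    and taylor: "\<And>j N x h. \<lbrakk>j < N; 0 \<le> h\<rbrakk> \<Longrightarrow> norm (F j (x + h)) \<le>
          (\<Sum>i<N - j. norm (F (j + i) x) * (h ^ i / fact i)) + M N * (h ^ (N - j) / fact (N - j))"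
    and zero: "\<And>j. F j 0 = 0"
    and t: "0 \<le> t"
  shows "F 0 t = 0"
proof -
  have "norm (F 0 t) \<le> exp (- real K) * M 0" for K
  proof -
    obtain n where "t * exp 1 \<le> (\<Sum>i\<in>{K..<K + n}. 1 / \<mu> i)"
      using not_summable_block_sums[OF _ div] \<mu>0 by (meson less_imp_le zero_le_divide_1_iff)
    from bang_flatness_propagates[OF M0 \<mu>0 mono ratio bound taylor zero t this, of 0]
    show ?thesis by simp
  qed
  moreover have "(\<lambda>K. exp (- real K) * M 0) \<longlonglongrightarrow> 0"
    by (intro tendsto_mult_left_zero filterlim_compose[OF exp_at_bot]
        filterlim_compose[OF filterlim_uminus_at_bot_at_top] filterlim_real_sequentially)
  ultimately have "norm (F 0 t) \<le> 0"
    by (intro LIMSEQ_le_const[where X = "\<lambda>K. exp (- real K) * M 0"]) auto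
  then show ?thesis by simp
qed

section \<open>Carleman's criterion on the line\<close>

text \<open>
Up to the factor \<open>\<i>\<^sup>j\<close>, this is the \<open>j\<close>-th derivative of the characteristic function of \<open>P\<close>. The
integral is used directly, so that no differentiation under the integral is needed.
\<close>

definition char_moment :: "real measure \<Rightarrow> nat \<Rightarrow> real \<Rightarrow> complex" where
  "char_moment P j t = (CLINT z|P. complex_of_real (z ^ j) * iexp (t * z))"

context
  fixes P :: "real measure"
  assumes dist: "real_distribution P"
    and moments: "\<And>n. integrable P (\<lambda>z. \<bar>z\<bar> ^ n)"
begin

interpretation real_distribution P by (rule dist)

lemma integrable_char_moment:
  "integrable P (\<lambda>z. complex_of_real (z ^ j) * iexp (t * z))"
  by (rule Bochner_Integration.integrable_bound[OF moments[of j]])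
    (auto simp: norm_mult norm_power)

lemma norm_char_moment_le: "norm (char_moment P j t) \<le> (LINT z|P. \<bar>z\<bar> ^ j)"
proof -
  have "norm (char_moment P j t) \<le> (LINT z|P. norm (complex_of_real (z ^ j) * iexp (t * z)))"
    unfolding char_moment_def by (rule integral_norm_bound)
  also have "\<dots> = (LINT z|P. \<bar>z\<bar> ^ j)" by (simp add: norm_mult norm_power)
  finally show ?thesis .
qed

text \<open>
Taylor's formula for the exponential, \<open>iexp_approx1\<close>, is applied under the integral with increment
\<open>h z\<close>; the powers of \<open>z\<close> that appear shift the index of the moments.
\<close>

lemma char_moment_taylor:
  assumes n: "0 < n"
  shows "norm (char_moment P j (x + h) - (\<Sum>i<n. (\<i> * h) ^ i / fact i * char_moment P (j + i) x))
    \<le> (LINT z|P. \<bar>z\<bar> ^ (j + n)) * (\<bar>h\<bar> ^ n / fact n)"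
proof -
  obtain m where m: "n = Suc m" using n by (cases n) auto
  let ?S = "\<lambda>z::real. \<Sum>i<n. (\<i> * h) ^ i / fact i * (complex_of_real (z ^ (j + i)) * iexp (x * z))"
  have "(\<Sum>i<n. (\<i> * h) ^ i / fact i * char_moment P (j + i) x) = (CLINT z|P. ?S z)"
    unfolding char_moment_def
    by (subst Bochner_Integration.integral_sum)
      (intro integrable_mult_right integrable_char_moment sum.cong refl
        integral_mult_right_zero[symmetric])+
  then have "char_moment P j (x + h) - (\<Sum>i<n. (\<i> * h) ^ i / fact i * char_moment P (j + i) x)
      = (CLINT z|P. complex_of_real (z ^ j) * iexp ((x + h) * z) - ?S z)"
    unfolding char_moment_def
    by (subst Bochner_Integration.integral_diff)
      (simp_all only: integrable_char_moment Bochner_Integration.integrable_sum integrable_mult_right)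
  moreover have "norm (CLINT z|P. complex_of_real (z ^ j) * iexp ((x + h) * z) - ?S z)
      \<le> (LINT z|P. \<bar>z\<bar> ^ (j + n) * (\<bar>h\<bar> ^ n / fact n))"
  proof (rule order_trans[OF integral_norm_bound], rule integral_mono)
    show "integrable P (\<lambda>z. norm (complex_of_real (z ^ j) * iexp ((x + h) * z) - ?S z))"
      by (intro integrable_norm Bochner_Integration.integrable_diff integrable_char_moment
          Bochner_Integration.integrable_sum integrable_mult_right)
    show "integrable P (\<lambda>z. \<bar>z\<bar> ^ (j + n) * (\<bar>h\<bar> ^ n / fact n))"
      by (intro integrable_mult_left moments)
    fix z :: real
    have "complex_of_real (z ^ j) * iexp ((x + h) * z) - ?S z = complex_of_real (z ^ j) * iexp (x * z) *
        (iexp (h * z) - (\<Sum>i<n. (\<i> * (h * z)) ^ i / fact i))"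
    proof -
      have "iexp ((x + h) * z) = iexp (x * z) * iexp (h * z)"
        by (simp add: exp_add[symmetric] algebra_simps)
      moreover have "?S z = complex_of_real (z ^ j) * iexp (x * z) * (\<Sum>i<n. (\<i> * (h * z)) ^ i / fact i)"
        by (simp add: sum_distrib_left power_mult_distrib power_add mult_ac)
      ultimately show ?thesis by (simp add: algebra_simps)
    qed
    then have "norm (complex_of_real (z ^ j) * iexp ((x + h) * z) - ?S z) =
        \<bar>z\<bar> ^ j * norm (iexp (h * z) - (\<Sum>i\<le>m. (\<i> * (h * z)) ^ i / fact i))"
      by (simp add: norm_mult norm_power m lessThan_Suc_atMost)
    also have "\<dots> \<le> \<bar>z\<bar> ^ j * (\<bar>h * z\<bar> ^ n / fact n)"
      unfolding m using iexp_approx1[of "h * z" m] by (intro mult_left_mono) auto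
    also have "\<dots> = \<bar>z\<bar> ^ (j + n) * (\<bar>h\<bar> ^ n / fact n)"
      by (simp add: abs_mult power_mult_distrib power_add)
    finally show "norm (complex_of_real (z ^ j) * iexp ((x + h) * z) - ?S z)
        \<le> \<bar>z\<bar> ^ (j + n) * (\<bar>h\<bar> ^ n / fact n)" .
  qed
  ultimately show ?thesis by simp
qed

end

lemma char_uminus: "char P (- t) = cnj (char P t)"
proof -
  have "iexp (- t * x) = cnj (iexp (t * x))" for x by (simp add: exp_cnj)
  then show ?thesis
    unfolding char_def by (simp only: Bochner_Integration.integral_cnj)
qed

text \<open>
Carleman's criterion on the whole line. Equality of all moments makes the differences of the
derivatives of the two characteristic functions vanish at the origin, and the absolute moments bound
them everywhere, so quasi-analyticity forces them to vanish on the positive half-line. The negative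
half-line follows by conjugation.
\<close>

theorem carleman_hamburger:
  fixes P Q :: "real measure" and M \<mu> :: "nat \<Rightarrow> real"
  assumes P: "real_distribution P" "\<And>n. integrable P (\<lambda>z. \<bar>z\<bar> ^ n)" "\<And>n. (LINT z|P. \<bar>z\<bar> ^ n) \<le> M n"
    and Q: "real_distribution Q" "\<And>n. integrable Q (\<lambda>z. \<bar>z\<bar> ^ n)" "\<And>n. (LINT z|Q. \<bar>z\<bar> ^ n) \<le> M n"
    and eq: "\<And>n. (LINT z|P. z ^ n) = (LINT z|Q. z ^ n)"
    and \<mu>0: "\<And>n. 0 < \<mu> n" and mono: "mono \<mu>"
    and ratio: "\<And>n. M (Suc n) = \<mu> n * M n" and div: "\<not> summable (\<lambda>n. 1 / \<mu> n)"
  shows "P = Q"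
proof (rule Levy_uniqueness[OF P(1) Q(1)])
  define F where "F = (\<lambda>j t. char_moment P j t - char_moment Q j t)"
  have M0: "0 \<le> M n" for n
    using P(3)[of n] by (rule order_trans[rotated]) (intro integral_nonneg_AE, simp)
  have bound: "norm (F j x) \<le> 2 * M j" for j x
    unfolding F_def
    using norm_triangle_ineq4[of "char_moment P j x" "char_moment Q j x"]
      norm_char_moment_le[OF P(1,2), of j x] norm_char_moment_le[OF Q(1,2), of j x] P(3)[of j] Q(3)[of j]
    by linarith
  have taylor: "norm (F j (x + h)) \<le>
      (\<Sum>i<N - j. norm (F (j + i) x) * (h ^ i / fact i)) + 2 * M N * (h ^ (N - j) / fact (N - j))"
    if "j < N" "0 \<le> h" for j N x h
  proof -
    define T where "T = (\<lambda>\<phi>. \<Sum>i<N - j. (\<i> * h) ^ i / fact i * \<phi> (j + i) x)"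
    have rem: "norm (char_moment R j (x + h) - T (char_moment R)) \<le> M N * (h ^ (N - j) / fact (N - j))"
      if R: "real_distribution R" "\<And>n. integrable R (\<lambda>z. \<bar>z\<bar> ^ n)" "\<And>n. (LINT z|R. \<bar>z\<bar> ^ n) \<le> M n" for R
    proof -
      have "norm (char_moment R j (x + h) - T (char_moment R))
          \<le> (LINT z|R. \<bar>z\<bar> ^ N) * (h ^ (N - j) / fact (N - j))"
        using char_moment_taylor[OF R(1,2), of "N - j" j x h] that \<open>j < N\<close> \<open>0 \<le> h\<close> by (simp add: T_def)
      also have "\<dots> \<le> M N * (h ^ (N - j) / fact (N - j))"
        using \<open>0 \<le> h\<close> by (intro mult_right_mono R(3)) auto
      finally show ?thesis .
    qed
    have "T (char_moment P) - T (char_moment Q) = T F"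
      unfolding T_def F_def sum_subtractf[symmetric] by (simp add: right_diff_distrib diff_divide_distrib)
    then have "F j (x + h) = T F + ((char_moment P j (x + h) - T (char_moment P))
        - (char_moment Q j (x + h) - T (char_moment Q)))"
      by (simp add: F_def algebra_simps)
    then have "norm (F j (x + h)) \<le> norm (T F) + (norm (char_moment P j (x + h) - T (char_moment P))
        + norm (char_moment Q j (x + h) - T (char_moment Q)))"
      by (metis add_left_mono norm_triangle_ineq norm_triangle_ineq4 order_trans)
    moreover have "norm (T F) \<le> (\<Sum>i<N - j. norm (F (j + i) x) * (h ^ i / fact i))"
      unfolding T_def using \<open>0 \<le> h\<close>
      by (intro sum_norm_le) (simp add: norm_mult norm_divide norm_power mult_ac)
    ultimately show ?thesis using rem[OF P] rem[OF Q] by linarith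
  qed
  have zero: "F j 0 = 0" for j
    unfolding F_def char_moment_def using eq[of j]
    by (simp del: of_real_power add: integral_complex_of_real)
  have pos: "char P t = char Q t" if "0 \<le> t" for t
  proof -
    have "F 0 t = 0"
      by (rule bang_quasianalytic[where M = "\<lambda>n. 2 * M n", OF _ \<mu>0 mono _ div bound taylor zero that])
        (simp_all add: M0 ratio)
    then show ?thesis by (simp add: F_def char_moment_def char_def)
  qed
  show "char P = char Q"
  proof
    fix t :: real
    show "char P t = char Q t"
      using pos[of t] pos[of "- t"] char_uminus[of P t] char_uminus[of Q t]
      by (cases "0 \<le> t") (simp_all add: complex_cnj_cancel_iff)
  qed
qed

section \<open>Carleman's criterion on the half-line\<close>

text \<open>
The law of \<open>\<plusminus>\<surd>X\<close> with a fair independent sign, where \<open>X\<close> has law \<open>\<mu>\<close>. It turns a moment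
problem on the half-line into one on the line: its even moments are the moments of \<open>\<mu>\<close> and its odd
moments vanish, and \<open>\<mu>\<close> is recovered by squaring. Since its moment of order \<open>2 n\<close> is only the
\<open>n\<close>-th moment of \<open>\<mu>\<close>, the half-line tolerates moments that grow like the square of what the line allows.
\<close>

definition symmetrize :: "real measure \<Rightarrow> real measure" where
  "symmetrize \<mu> = distr (\<mu> \<Otimes>\<^sub>M measure_pmf (pmf_of_set (UNIV :: bool set))) borel
     (\<lambda>(x, b). if b then sqrt x else - sqrt x)"

context
  fixes \<mu> :: "real measure"
  assumes dist: "real_distribution \<mu>"
begin

interpretation real_distribution \<mu> by (rule dist)

abbreviation "coin \<equiv> measure_pmf (pmf_of_set (UNIV :: bool set))"

interpretation pair: pair_prob_space \<mu> coin
  by (intro pair_prob_space.intro pair_sigma_finite.intro)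
    (unfold_locales)

lemma symmetrize_map [measurable]:
  "(\<lambda>(x, b). if b then sqrt x else - sqrt x) \<in> borel_measurable (\<mu> \<Otimes>\<^sub>M coin)"
  by measurable

lemma real_distribution_symmetrize: "real_distribution (symmetrize \<mu>)"
  unfolding symmetrize_def by (rule pair.real_distribution_distr) measurable

text \<open>
An even function does not see the sign, so only the first factor of the product space matters.
\<close>

lemma distr_symmetrize_even:
  assumes f[measurable]: "f \<in> borel_measurable borel" and even: "\<And>z. f (- z) = f z"
  shows "distr (symmetrize \<mu>) borel f = distr \<mu> borel (\<lambda>x. f (sqrt x))"
proof -
  have "distr (symmetrize \<mu>) borel f = distr (\<mu> \<Otimes>\<^sub>M coin) borel ((\<lambda>x. f (sqrt x)) \<circ> fst)"
    unfolding symmetrize_def by (subst distr_distr) (auto simp: comp_def even intro!: distr_cong)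
  also have "\<dots> = distr (distr (\<mu> \<Otimes>\<^sub>M coin) \<mu> fst) borel (\<lambda>x. f (sqrt x))"
    by (subst distr_distr) auto
  finally show ?thesis by (simp only: measure_pmf.distr_pair_fst)
qed

lemma symmetrize_integral_even:
  fixes f :: "real \<Rightarrow> real"
  assumes f[measurable]: "f \<in> borel_measurable borel" and even: "\<And>z. f (- z) = f z"
  shows "(LINT z|symmetrize \<mu>. f z) = (LINT x|\<mu>. f (sqrt x))"
    and "integrable (symmetrize \<mu>) f \<longleftrightarrow> integrable \<mu> (\<lambda>x. f (sqrt x))"
proof -
  have [measurable_cong]: "sets (symmetrize \<mu>) = sets borel" by (simp add: symmetrize_def)
  note * = distr_symmetrize_even[of f, OF f even]
  show "(LINT z|symmetrize \<mu>. f z) = (LINT x|\<mu>. f (sqrt x))"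
    using arg_cong[OF *, of "\<lambda>N. LINT x|N. x"] by (simp add: integral_distr)
  show "integrable (symmetrize \<mu>) f \<longleftrightarrow> integrable \<mu> (\<lambda>x. f (sqrt x))"
    using arg_cong[OF *, of "\<lambda>N. integrable N (\<lambda>x. x)"] by (simp add: integrable_distr_eq)
qed

lemma symmetrize_integral_odd:
  fixes f :: "real \<Rightarrow> real"
  assumes f[measurable]: "f \<in> borel_measurable borel" and odd: "\<And>z. f (- z) = - f z"
    and int: "integrable (symmetrize \<mu>) f"
  shows "(LINT z|symmetrize \<mu>. f z) = 0"
proof -
  let ?g = "\<lambda>x b. f (if b then sqrt x else - sqrt x)"
  have int': "integrable (\<mu> \<Otimes>\<^sub>M coin) (case_prod ?g)"
    using int unfolding symmetrize_def by (subst (asm) integrable_distr_eq) (auto simp: case_prod_unfold)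
  have "(LINT z|symmetrize \<mu>. f z) = integral\<^sup>L (\<mu> \<Otimes>\<^sub>M coin) (case_prod ?g)"
    unfolding symmetrize_def by (subst integral_distr) (auto simp: case_prod_unfold)
  also have "\<dots> = (LINT x|\<mu>. LINT b|coin. ?g x b)"
    by (rule pair.integral_fst[OF int', symmetric])
  also have "\<dots> = (LINT x|\<mu>. 0)"
    by (intro Bochner_Integration.integral_cong refl) (simp add: integral_pmf_of_set UNIV_bool odd)
  finally show ?thesis by simp
qed

lemma distr_symmetrize_square:
  assumes nonneg: "AE x in \<mu>. 0 \<le> x"
  shows "distr (symmetrize \<mu>) borel (\<lambda>z. z\<^sup>2) = \<mu>"
proof -
  have "distr (symmetrize \<mu>) borel (\<lambda>z. z\<^sup>2) = distr \<mu> borel (\<lambda>x. (sqrt x)\<^sup>2)"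
    by (rule distr_symmetrize_even) auto
  also have "\<dots> = distr \<mu> borel (\<lambda>x. x)"
    using nonneg by (intro distr_cong_AE) auto
  also have "\<dots> = \<mu>" by (rule distr_id2) simp
  finally show ?thesis .
qed

end

text \<open>
This replaces the Cauchy--Schwarz inequality for the odd absolute moments. It has a free weight \<open>c\<close>,
which can be chosen so that both terms on the right get the same bound.
\<close>

lemma odd_power_le_even_powers:
  fixes r c :: real
  assumes "0 < c" "0 \<le> r"
  shows "r ^ Suc (2 * m) \<le> (c * r ^ (2 * m) + r ^ (2 * Suc m) / c) / 2"
proof -
  have "0 \<le> r ^ (2 * m) * ((c - r)\<^sup>2 / c)" using assms by simp
  also have "\<dots> = c * r ^ (2 * m) + r ^ (2 * Suc m) / c - 2 * r ^ Suc (2 * m)"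
    using assms by (simp add: field_simps power2_eq_square)
  finally show ?thesis by simp
qed

lemma prod_half_index:
  fixes c :: "nat \<Rightarrow> real"
  shows "(\<Prod>i<2 * m. c (i div 2)) = (\<Prod>i<m. c i)\<^sup>2"
  by (induction m) (simp_all add: power2_eq_square)

text \<open>
Each ratio \<open>c i\<close> is used twice in a row, for an even and for the next odd moment. With this choice the
interpolated bound for the odd moments is exactly the next partial product, and no constant is lost.
\<close>

lemma symmetrize_abs_moment:
  assumes \<mu>: "nonneg_dist_finite_moments \<mu>" and c: "\<And>n. 0 < c n"
    and bound: "\<And>n. (LINT x|\<mu>. x ^ n) \<le> A * (\<Prod>i<n. c i)\<^sup>2"
  shows "integrable (symmetrize \<mu>) (\<lambda>z. \<bar>z\<bar> ^ n)"
    and "(LINT z|symmetrize \<mu>. \<bar>z\<bar> ^ n) \<le> A * (\<Prod>i<n. c (i div 2))"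
proof -
  interpret real_distribution \<mu> using \<mu> by (simp add: nonneg_dist_finite_moments_def)
  have D: "real_distribution \<mu>" by unfold_locales
  have nonneg: "AE x in \<mu>. 0 \<le> x" using \<mu> by (simp add: nonneg_dist_finite_moments_def)
  have mom: "integrable \<mu> (\<lambda>x. x ^ k)" for k
    using \<mu> by (cases "k = 0") (auto simp: nonneg_dist_finite_moments_def)
  have root_pow: "AE x in \<mu>. \<bar>sqrt x\<bar> ^ (2 * k) = x ^ k" for k
    using nonneg by eventually_elim (simp add: power_mult)
  have even: "integrable \<mu> (\<lambda>x. \<bar>sqrt x\<bar> ^ (2 * k))"
    "(LINT x|\<mu>. \<bar>sqrt x\<bar> ^ (2 * k)) \<le> A * (\<Prod>i<k. c i)\<^sup>2" for k
  proof -
    show "integrable \<mu> (\<lambda>x. \<bar>sqrt x\<bar> ^ (2 * k))"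
      by (subst integrable_cong_AE[OF _ _ root_pow]) (simp_all add: mom)
    show "(LINT x|\<mu>. \<bar>sqrt x\<bar> ^ (2 * k)) \<le> A * (\<Prod>i<k. c i)\<^sup>2"
      by (subst integral_cong_AE[OF _ _ root_pow]) (simp_all add: bound)
  qed
  have "integrable \<mu> (\<lambda>x. \<bar>sqrt x\<bar> ^ n) \<and> (LINT x|\<mu>. \<bar>sqrt x\<bar> ^ n) \<le> A * (\<Prod>i<n. c (i div 2))"
  proof (cases "even n")
    case True
    then obtain k where "n = 2 * k" by blast
    then show ?thesis using even[of k] by (simp only: prod_half_index simp_thms)
  next
    case False
    then obtain k where n: "n = Suc (2 * k)" by (auto elim: oddE)
    let ?b = "\<lambda>x. (c k * \<bar>sqrt x\<bar> ^ (2 * k) + \<bar>sqrt x\<bar> ^ (2 * Suc k) / c k) / 2"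
    have le: "\<bar>sqrt x\<bar> ^ n \<le> ?b x" for x
      unfolding n by (intro odd_power_le_even_powers c) simp
    have b: "integrable \<mu> ?b"
      by (intro integrable_divide Bochner_Integration.integrable_add integrable_mult_right even)
    then have int: "integrable \<mu> (\<lambda>x. \<bar>sqrt x\<bar> ^ n)"
    proof (rule Bochner_Integration.integrable_bound)
      show "AE x in \<mu>. norm (\<bar>sqrt x\<bar> ^ n) \<le> norm (?b x)"
        using le by (intro AE_I2) (metis abs_ge_zero abs_le_D1 abs_of_nonneg order_trans real_norm_def zero_le_power)
    qed simp
    have "(LINT x|\<mu>. \<bar>sqrt x\<bar> ^ n) \<le> (LINT x|\<mu>. ?b x)"
      by (intro integral_mono int b le)
    also have "\<dots> = (c k * (LINT x|\<mu>. \<bar>sqrt x\<bar> ^ (2 * k)) + (LINT x|\<mu>. \<bar>sqrt x\<bar> ^ (2 * Suc k)) / c k) / 2"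
      using even(1)[of k] even(1)[of "Suc k"] by (simp del: real_sqrt_abs power_Suc mult_Suc_right)
    also have "\<dots> \<le> (c k * (A * (\<Prod>i<k. c i)\<^sup>2) + A * (\<Prod>i<Suc k. c i)\<^sup>2 / c k) / 2"
      using c[of k] by (intro divide_right_mono add_mono mult_left_mono even) auto
    also have "\<dots> = A * ((\<Prod>i<k. c i)\<^sup>2 * c k)"
      using c[of k] by (simp add: field_simps power2_eq_square)
    also have "\<dots> = A * (\<Prod>i<n. c (i div 2))"
      by (simp add: n prod_half_index)
    finally show ?thesis using int by simp
  qed
  then show "integrable (symmetrize \<mu>) (\<lambda>z. \<bar>z\<bar> ^ n)"
    and "(LINT z|symmetrize \<mu>. \<bar>z\<bar> ^ n) \<le> A * (\<Prod>i<n. c (i div 2))"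
    using symmetrize_integral_even[OF D, of "\<lambda>z. \<bar>z\<bar> ^ n"] by simp_all
qed

lemma symmetrize_moment:
  assumes \<mu>: "nonneg_dist_finite_moments \<mu>"
    and int: "\<And>n. integrable (symmetrize \<mu>) (\<lambda>z. \<bar>z\<bar> ^ n)"
  shows "(LINT z|symmetrize \<mu>. z ^ n) = (if even n then LINT x|\<mu>. x ^ (n div 2) else 0)"
proof -
  have D: "real_distribution \<mu>" and nonneg: "AE x in \<mu>. 0 \<le> x"
    using \<mu> by (auto simp: nonneg_dist_finite_moments_def)
  interpret real_distribution \<mu> by (rule D)
  have [measurable_cong]: "sets (symmetrize \<mu>) = sets borel" by (simp add: symmetrize_def)
  show ?thesis
  proof (cases "even n")
    case True
    then obtain k where n: "n = 2 * k" by blast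
    have "(LINT z|symmetrize \<mu>. z ^ n) = (LINT x|\<mu>. sqrt x ^ n)"
      using True by (intro symmetrize_integral_even[OF D]) auto
    also have "\<dots> = (LINT x|\<mu>. x ^ k)"
      using nonneg by (intro integral_cong_AE) (auto simp: n power_mult)
    finally show ?thesis by (simp add: n)
  next
    case False
    have "integrable (symmetrize \<mu>) (\<lambda>z. z ^ n)"
      by (rule Bochner_Integration.integrable_bound[OF int[of n]]) (auto simp: power_abs)
    then show ?thesis
      using False by (simp add: symmetrize_integral_odd[OF D])
  qed
qed

text \<open>
Carleman's criterion on the half-line, in ratio form. A competitor \<open>\<nu>\<close> has the same moments and hence
the same bounds, so the criterion on the whole line applies to the two symmetrized laws.
\<close>

theorem carleman_stieltjes:
  fixes c :: "nat \<Rightarrow> real"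
  assumes \<mu>: "nonneg_dist_finite_moments \<mu>"
    and c: "\<And>n. 0 < c n" "mono c" "\<not> summable (\<lambda>n. 1 / c n)"
    and bound: "\<And>n. (LINT x|\<mu>. x ^ n) \<le> A * (\<Prod>i<n. c i)\<^sup>2"
  shows "M_det_dist \<mu>"
  unfolding M_det_dist_def
proof (intro conjI allI impI, fact \<mu>, elim conjE)
  fix \<nu> assume \<nu>: "nonneg_dist_finite_moments \<nu>" and eq: "\<forall>n\<ge>1. (LINT x|\<nu>. x ^ n) = (LINT x|\<mu>. x ^ n)"
  have D: "real_distribution \<mu>" "real_distribution \<nu>"
    and nonneg: "AE x in \<mu>. 0 \<le> x" "AE x in \<nu>. 0 \<le> x"
    using \<mu> \<nu> by (auto simp: nonneg_dist_finite_moments_def)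
  have eq': "(LINT x|\<nu>. x ^ n) = (LINT x|\<mu>. x ^ n)" for n
    using eq D[THEN real_distribution.axioms(1)] by (cases "n = 0") (auto simp: prob_space.prob_space)
  have bound': "(LINT x|\<nu>. x ^ n) \<le> A * (\<Prod>i<n. c i)\<^sup>2" for n
    using bound by (simp add: eq')
  note int = symmetrize_abs_moment[OF \<mu> c(1) bound] symmetrize_abs_moment[OF \<nu> c(1) bound']
  have "symmetrize \<nu> = symmetrize \<mu>"
  proof (rule carleman_hamburger[where \<mu> = "\<lambda>n. c (n div 2)" and M = "\<lambda>n. A * (\<Prod>i<n. c (i div 2))"])
    show "(LINT z|symmetrize \<nu>. z ^ n) = (LINT z|symmetrize \<mu>. z ^ n)" for n
      by (simp add: symmetrize_moment \<mu> \<nu> int eq')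
    show "mono (\<lambda>n. c (n div 2))"
      by (intro monoI monoD[OF c(2)] div_le_mono)
    show "\<not> summable (\<lambda>n. 1 / c (n div 2))"
    proof
      assume "summable (\<lambda>n. 1 / c (n div 2))"
      then have "summable ((\<lambda>n. 1 / c (n div 2)) \<circ> (\<lambda>k. 2 * k))"
        using c(1) by (intro summable_reindex) (auto simp: inj_on_def less_imp_le)
      with c(3) show False by (simp add: comp_def)
    qed
  qed (auto simp: real_distribution_symmetrize D int c(1))
  then show "\<nu> = \<mu>"
    using distr_symmetrize_square[OF D(1) nonneg(1)] distr_symmetrize_square[OF D(2) nonneg(2)] by simp
qed

section \<open>The sequence n log n\<close>

definition log_weight :: "nat \<Rightarrow> real" where
  "log_weight n = real (n + 1) * ln (real (n + 3))"

lemma one_less_ln_3: "1 < ln (3 :: real)"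
proof -
  have "ln (exp 1) < ln (3 :: real)" using e_less_272 by (subst ln_less_cancel_iff) auto
  then show ?thesis by simp
qed

lemma one_less_ln: "1 < ln (real (n + 3))"
proof -
  have "ln 3 \<le> ln (real (n + 3))" by simp
  with one_less_ln_3 show ?thesis by linarith
qed

lemma log_weight_ge_1: "1 \<le> log_weight n"
  unfolding log_weight_def using one_less_ln[of n]
  by (intro mult_ge1_I) auto

lemma log_weight_pos: "0 < log_weight n"
  using log_weight_ge_1[of n] by linarith

lemma mono_log_weight: "mono log_weight"
  unfolding log_weight_def using one_less_ln less_imp_le[OF less_trans[OF zero_less_one]]
  by (intro monoI mult_mono) auto

lemma ln_Suc_diff_le: "ln (real (Suc n + 3)) - ln (real (n + 3)) \<le> 1 / real (n + 3)"
proof -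
  have "ln (real (Suc n + 3)) - ln (real (n + 3)) = ln (real (Suc n + 3) / real (n + 3))"
    by (simp add: ln_div)
  also have "\<dots> \<le> real (Suc n + 3) / real (n + 3) - 1"
    by (rule ln_le_minus_one) simp
  also have "\<dots> = 1 / real (n + 3)" by (simp add: field_simps)
  finally show ?thesis .
qed

text \<open>
The sequence varies regularly: the relative increments of \<open>n + 1\<close> and of \<open>ln (n + 3)\<close> are both at
most \<open>1 / (n + 1)\<close>.
\<close>

lemma log_weight_Suc_le: "log_weight (Suc n) \<le> log_weight n * exp (2 / real (Suc n))"
proof -
  let ?u = "1 + 1 / real (Suc n)"
  have "1 / real (n + 3) \<le> 1 / real (Suc n) * ln (real (n + 3))"
  proof -
    have "1 / real (n + 3) \<le> 1 / real (Suc n) * 1" by (simp add: frac_le)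
    also have "\<dots> \<le> 1 / real (Suc n) * ln (real (n + 3))"
      using one_less_ln[of n] by (intro mult_left_mono) auto
    finally show ?thesis .
  qed
  with ln_Suc_diff_le[of n] have "ln (real (Suc n + 3)) \<le> ?u * ln (real (n + 3))"
    unfolding distrib_right by linarith
  then have "log_weight (Suc n) \<le> (real (n + 1) * ?u) * (?u * ln (real (n + 3)))"
    unfolding log_weight_def by (intro mult_mono) (auto simp: field_simps)
  also have "\<dots> = log_weight n * (?u * ?u)"
    by (simp add: log_weight_def)
  also have "\<dots> \<le> log_weight n * (exp (1 / real (Suc n)) * exp (1 / real (Suc n)))"
    using exp_ge_add_one_self[of "1 / real (Suc n)"]
    by (intro mult_left_mono mult_mono) (auto simp: less_imp_le[OF log_weight_pos])
  also have "\<dots> = log_weight n * exp (2 / real (Suc n))"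
    by (simp add: exp_add[symmetric])
  finally show ?thesis .
qed

text \<open>
A Stirling-type estimate: replacing the power by the product over smaller indices costs only a
geometric factor, because by the previous lemma passing from \<open>n\<close> to \<open>n + 1\<close> multiplies the power
by at most \<open>e\<^sup>2\<close> times the new factor of the product.
\<close>

lemma log_weight_power_le_prod: "log_weight n ^ n \<le> exp 2 ^ n * (\<Prod>i<n. log_weight i)"
proof (induction n)
  case (Suc n)
  have "log_weight (Suc n) ^ Suc n \<le> (log_weight n * exp (2 / real (Suc n))) ^ Suc n"
    by (intro power_mono log_weight_Suc_le less_imp_le[OF log_weight_pos])
  also have "\<dots> = log_weight n ^ Suc n * exp 2"
  proof -
    have "real (Suc n) * (2 / real (Suc n)) = 2" by (simp del: of_nat_Suc)
    then have "exp (2 / real (Suc n)) ^ Suc n = exp 2" by (simp only: exp_of_nat_mult[symmetric])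
    then show ?thesis by (simp only: power_mult_distrib)
  qed
  also have "\<dots> = log_weight n ^ n * (log_weight n * exp 2)" by simp
  also have "\<dots> \<le> (exp 2 ^ n * (\<Prod>i<n. log_weight i)) * (log_weight n * exp 2)"
    by (intro mult_right_mono Suc.IH) (simp add: less_imp_le[OF log_weight_pos])
  finally show ?case by (simp add: mult_ac)
qed simp

text \<open>
The iterated logarithm tends to infinity, and its increments are below the terms of this series.
\<close>

lemma not_summable_inverse_log_weight: "\<not> summable (\<lambda>n. 1 / log_weight n)"
proof
  define h where "h = (\<lambda>n. ln (ln (real (n + 3))))"
  assume "summable (\<lambda>n. 1 / log_weight n)"
  moreover have "norm (h (Suc n) - h n) \<le> 1 / log_weight n" for n
  proof -
    have L: "1 < ln (real (n + 3))" "1 < ln (real (Suc n + 3))" by (rule one_less_ln)+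
    have "h (Suc n) - h n = ln (ln (real (Suc n + 3)) / ln (real (n + 3)))"
      unfolding h_def using L by (simp add: ln_div)
    also have "\<dots> \<le> ln (real (Suc n + 3)) / ln (real (n + 3)) - 1"
      using L by (intro ln_le_minus_one) auto
    also have "\<dots> = (ln (real (Suc n + 3)) - ln (real (n + 3))) / ln (real (n + 3))"
      using L by (simp add: diff_divide_distrib)
    also have "\<dots> \<le> (1 / real (n + 3)) / ln (real (n + 3))"
      using L by (intro divide_right_mono ln_Suc_diff_le) auto
    also have "\<dots> \<le> 1 / log_weight n"
      unfolding log_weight_def using L by (simp add: frac_le)
    finally have "h (Suc n) - h n \<le> 1 / log_weight n" .
    moreover have "h n \<le> h (Suc n)" using L by (simp add: h_def)
    ultimately show ?thesis by simp
  qed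
  ultimately have "summable (\<lambda>n. h (Suc n) - h n)"
    by (rule summable_comparison_test')
  then have "convergent (\<lambda>n. h n - h 0)"
    by (simp add: summable_iff_convergent sum_lessThan_telescope)
  then obtain l where "(\<lambda>n. h n - h 0) \<longlonglongrightarrow> l" by (auto simp: convergent_def)
  then have "(\<lambda>n. h n - h 0 + h 0) \<longlonglongrightarrow> l + h 0" by (intro tendsto_intros)
  then have "h \<longlonglongrightarrow> l + h 0" by simp
  moreover have "filterlim (\<lambda>n. real (n + 3)) at_top sequentially"
    by (rule filterlim_compose[OF filterlim_real_sequentially filterlim_add_const_nat_at_top])
  then have "filterlim h at_top sequentially"
    unfolding h_def by (intro filterlim_compose[OF ln_at_top])
  ultimately show False
    using not_tendsto_and_filterlim_at_infinity filterlim_at_top_imp_at_infinity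
      trivial_limit_sequentially by blast
qed

section \<open>Moments of a geometrically decaying density\<close>

lemma set_integrable_power_mult:
  fixes g :: "real \<Rightarrow> real"
  assumes g: "set_integrable lborel {u..v} g" and u: "0 \<le> u"
  shows "set_integrable lborel {u..v} (\<lambda>x. x ^ k * g x)"
  unfolding set_integrable_def
proof (rule Bochner_Integration.integrable_bound)
  have [measurable]: "(\<lambda>x. indicator {u..v} x *\<^sub>R g x) \<in> borel_measurable borel"
    using g by (auto simp: set_integrable_def dest: borel_measurable_integrable)
  have "(\<lambda>x. x ^ k * (indicator {u..v} x *\<^sub>R g x)) \<in> borel_measurable lborel" by measurable
  then show "(\<lambda>x. indicator {u..v} x *\<^sub>R (x ^ k * g x)) \<in> borel_measurable lborel"
    by (simp add: mult_ac)
  show "integrable lborel (\<lambda>x. v ^ k * (indicator {u..v} x *\<^sub>R g x))"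
    using g unfolding set_integrable_def by (rule integrable_mult_right)
  show "AE x in lborel. norm (indicator {u..v} x *\<^sub>R (x ^ k * g x)) \<le> norm (v ^ k * (indicator {u..v} x *\<^sub>R g x))"
    using u by (intro AE_I2) (auto simp: indicator_def abs_mult power_abs intro!: mult_right_mono power_mono)
qed

text \<open>
Substituting \<open>T\<close> costs a factor \<open>p\<close> for the derivative and a factor \<open>p\<close> for the power, and gains the
factor \<open>q\<close> from the decay of the density.
\<close>

lemma density_moment_contraction:
  fixes g T T' :: "real \<Rightarrow> real"
  assumes X: "0 \<le> X" "X \<le> B"
    and int: "set_integrable lborel {X..T B} g" and g0: "\<And>x. X \<le> x \<Longrightarrow> 0 \<le> g x"
    and deriv: "\<And>x. X \<le> x \<Longrightarrow> (T has_real_derivative T' x) (at x)" and cont: "continuous_on {X..} T'"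
    and T': "\<And>x. X \<le> x \<Longrightarrow> 0 \<le> T' x" "\<And>x. X \<le> x \<Longrightarrow> T' x \<le> p"
    and step: "\<And>x. X \<le> x \<Longrightarrow> x \<le> T x" "\<And>x. X \<le> x \<Longrightarrow> T x ^ k \<le> p * x ^ k"
    and decay: "\<And>x. X \<le> x \<Longrightarrow> g (T x) \<le> q * g x"
  shows "(LINT x:{T X..T B}|lborel. x ^ k * g x) \<le> q * p\<^sup>2 * (LINT x:{X..B}|lborel. x ^ k * g x)"
proof -
  have int_TX: "set_integrable lborel {T X..T B} (\<lambda>x. x ^ k * g x)"
    using X step(1)[of X] by (intro set_integrable_power_mult set_integrable_subset[OF int]) auto
  have int_X: "set_integrable lborel {X..B} (\<lambda>x. x ^ k * g x)"
    using X step(1)[of B] by (intro set_integrable_power_mult set_integrable_subset[OF int]) auto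
  have cont_XB: "continuous_on {X..B} T'" using cont by (rule continuous_on_subset) auto
  have on_XB: "(T has_real_derivative T' x) (at x)" "0 \<le> T' x" if "x \<in> {X..B}" for x
    using that deriv T'(1) by auto
  note subst = integral_substitution[OF int_TX on_XB(1) cont_XB on_XB(2) X(2)]
  have "(LINT x:{T X..T B}|lborel. x ^ k * g x) = (LINT x:{X..B}|lborel. T x ^ k * g (T x) * T' x)"
    using subst(2) by (simp add: set_lebesgue_integral_def mult.commute)
  also have "\<dots> \<le> (LINT x:{X..B}|lborel. q * p\<^sup>2 * (x ^ k * g x))"
  proof (rule set_integral_mono)
    fix x assume "x \<in> {X..B}"
    then have x: "X \<le> x" by simp
    have "T x ^ k * g (T x) * T' x \<le> (p * x ^ k) * (q * g x) * p"
      using x X step[of x] T'[of x] decay[of x] g0[of "T x"] g0[of x]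
      by (intro mult_mono mult_nonneg_nonneg order_trans[OF zero_le_power step(2)]
          order_trans[OF g0 decay]) auto
    then show "T x ^ k * g (T x) * T' x \<le> q * p\<^sup>2 * (x ^ k * g x)"
      by (simp add: power2_eq_square mult_ac)
  qed (use subst(1) int_X in auto)
  also have "\<dots> = q * p\<^sup>2 * (LINT x:{X..B}|lborel. x ^ k * g x)"
    by simp
  finally show ?thesis .
qed

text \<open>
The integral over \<open>[X, B]\<close> is at most the one over \<open>[X, T X]\<close>, which is trivially bounded, plus the
one over \<open>[T X, T B]\<close>, which is a fixed fraction of the original integral. As this integral is finite,
it can be absorbed on the left.
\<close>

lemma truncated_density_moment_le:
  fixes g T T' :: "real \<Rightarrow> real"
  assumes X: "0 \<le> X" "X \<le> B"
    and int: "\<And>v. set_integrable lborel {X..v} g" and g0: "\<And>x. X \<le> x \<Longrightarrow> 0 \<le> g x"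
    and mass: "\<And>v. X \<le> v \<Longrightarrow> (LINT x:{X..v}|lborel. g x) \<le> 1"
    and deriv: "\<And>x. X \<le> x \<Longrightarrow> (T has_real_derivative T' x) (at x)" and cont: "continuous_on {X..} T'"
    and T': "\<And>x. X \<le> x \<Longrightarrow> 0 \<le> T' x" "\<And>x. X \<le> x \<Longrightarrow> T' x \<le> p"
    and step: "\<And>x. X \<le> x \<Longrightarrow> x \<le> T x" "\<And>x. X \<le> x \<Longrightarrow> T x ^ k \<le> p * x ^ k"
    and decay: "\<And>x. X \<le> x \<Longrightarrow> g (T x) \<le> q * g x"
    and contr: "q * p\<^sup>2 < 1"
  shows "(LINT x:{X..B}|lborel. x ^ k * g x) \<le> p / (1 - q * p\<^sup>2) * X ^ k"
proof -
  define J where "J = (\<lambda>u v. LINT x:{u..v}|lborel. x ^ k * g x)"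
  have int_J: "set_integrable lborel {u..v} (\<lambda>x. x ^ k * g x)" if "X \<le> u" for u v
    using that X by (intro set_integrable_power_mult set_integrable_subset[OF int[of v]]) auto
  have T_mono: "T X \<le> T B"
    using DERIV_nonneg_imp_nondecreasing[OF X(2), of T] deriv T'(1) by auto
  note TX = step(1)[OF order_refl] and TB = step(1)[OF X(2)]
  have "J X B \<le> J X (T B)"
    unfolding J_def set_lebesgue_integral_def using X TB g0 int_J[of X] 
    by (intro integral_mono) (auto simp: set_integrable_def indicator_def)
  also have "\<dots> = (LINT x:{X..T X} \<union> {T X..T B}|lborel. x ^ k * g x)"
    using TX T_mono by (simp add: J_def ivl_disj_un)
  also have "\<dots> = J X (T X) + J (T X) (T B)"
    unfolding J_def
  proof (rule set_integral_Un_AE)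
    show "AE x in lborel. \<not> (x \<in> {X..T X} \<and> x \<in> {T X..T B})"
      using AE_lborel_singleton[of "T X"] by eventually_elim auto
  qed (use TX int_J in auto)
  also have "J (T X) (T B) \<le> q * p\<^sup>2 * J X B"
    unfolding J_def by (rule density_moment_contraction[OF X int g0 deriv cont T' step decay])
  also have "J X (T X) \<le> p * X ^ k"
  proof -
    have "J X (T X) \<le> (LINT x:{X..T X}|lborel. T X ^ k * g x)"
      unfolding J_def using X g0 int_J int
      by (intro set_integral_mono) (auto intro!: mult_right_mono power_mono)
    also have "\<dots> = T X ^ k * (LINT x:{X..T X}|lborel. g x)" by simp
    also have "\<dots> \<le> T X ^ k * 1"
      using mass[OF TX] TX X by (intro mult_left_mono) auto
    also have "\<dots> \<le> p * X ^ k" using step(2)[of X] by simp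
    finally show ?thesis .
  qed
  finally have "(1 - q * p\<^sup>2) * J X B \<le> p * X ^ k"
    by (simp add: algebra_simps)
  then have "J X B \<le> p * X ^ k / (1 - q * p\<^sup>2)"
    using contr by (simp add: pos_le_divide_eq mult.commute)
  then show ?thesis by (simp add: J_def)
qed

text \<open>
Both measures give a half-line \<open>(x, \<infinity>)\<close> the increment of the distribution function over \<open>(y, B]\<close>,
where \<open>y\<close> is \<open>x\<close> moved into \<open>[x0, B]\<close>. The truncation at \<open>B\<close> is what keeps this a statement about
bounded intervals.
\<close>

lemma (in real_distribution) cdf_density_restrict_eq:
  assumes ac: "abs_cont_from_with_density (cdf M) x0 g" and g0: "\<And>x. x0 \<le> x \<Longrightarrow> 0 \<le> g x" and B: "x0 \<le> B"
  shows "density M (\<lambda>x. ennreal (indicator {x0<..B} x)) = density lborel (\<lambda>x. ennreal (indicator {x0<..B} x * g x))"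
    (is "?L = ?R")
proof (rule measure_eqI_lessThan)
  show "sets ?L = sets borel" "sets ?R = sets borel" by simp_all
  have int: "set_integrable lborel {u..v} g" if "x0 \<le> u" for u v
  proof (cases "x0 \<le> v")
    case True
    then have "set_integrable lborel {x0..v} g" using ac by (auto simp: abs_cont_from_with_density_def)
    then show ?thesis by (rule set_integrable_subset) (use that in auto)
  qed (use that in \<open>simp add: set_integrable_def\<close>)
  have int_Ioc: "set_integrable lborel {u<..v} g" if "x0 \<le> u" for u v
    by (rule set_integrable_subset[OF int[of u v]]) (use that in auto)
  have cdf_diff: "cdf M B - cdf M y = (LINT x:{y<..B}|lborel. g x)" if y: "x0 \<le> y" "y \<le> B" for y
  proof -
    have "(LINT x:{x0..B}|lborel. g x) = (LINT x:{x0..y} \<union> {y<..B}|lborel. g x)"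
      using y by (simp add: ivl_disj_un)
    also have "\<dots> = (LINT x:{x0..y}|lborel. g x) + (LINT x:{y<..B}|lborel. g x)"
      using y by (intro set_integral_Un int int_Ioc) auto
    moreover have "(LINT x:{x0..B}|lborel. g x) = cdf M B - cdf M x0"
      "(LINT x:{x0..y}|lborel. g x) = cdf M y - cdf M x0"
      using ac y B by (simp_all add: abs_cont_from_with_density_def)
    ultimately show ?thesis by simp
  qed
  have gm: "(\<lambda>x. indicator {x0<..B} x * g x) \<in> borel_measurable lborel"
    using int_Ioc[of x0 B] by (auto simp: set_integrable_def dest: borel_measurable_integrable)
  fix x
  define y where "y = max x0 (min x B)"
  have y: "x0 \<le> y" "y \<le> B" using B by (auto simp: y_def)
  have "emeasure ?L {x<..} = (\<integral>\<^sup>+t. ennreal (indicator {y<..B} t) \<partial>M)"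
    by (subst emeasure_density) (auto simp: y_def min_less_iff_disj indicator_def intro!: nn_integral_cong)
  also have "\<dots> = emeasure M {y<..B}"
    by (simp add: ennreal_indicator)
  also have "\<dots> = ennreal (cdf M B - cdf M y)"
    using y by (cases "y = B") (simp_all add: emeasure_eq_measure cdf_diff_eq)
  finally have L: "emeasure ?L {x<..} = ennreal (cdf M B - cdf M y)" .
  have "emeasure ?R {x<..} = (\<integral>\<^sup>+t. ennreal (indicator {y<..B} t *\<^sub>R g t) \<partial>lborel)"
    by (subst emeasure_density) (use gm in \<open>auto simp: y_def min_less_iff_disj indicator_def intro!: nn_integral_cong\<close>)
  also have "\<dots> = ennreal (LINT t:{y<..B}|lborel. g t)"
    unfolding set_lebesgue_integral_def
    using int_Ioc[of y B] y g0
    by (intro nn_integral_eq_integral) (auto simp: set_integrable_def indicator_def)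
  finally show "emeasure ?L {x<..} = emeasure ?R {x<..}" by (simp add: L cdf_diff[OF y])
  show "emeasure ?L {x<..} < \<infinity>" by (simp add: L)
qed

text \<open>
The left integral excludes \<open>X\<close> because the distribution may have an atom at \<open>x0\<close>.
\<close>

lemma (in real_distribution) truncated_expectation_eq:
  fixes f :: "real \<Rightarrow> real"
  assumes ac: "abs_cont_from_with_density (cdf M) x0 g" and g0: "\<And>x. x0 \<le> x \<Longrightarrow> 0 \<le> g x" and X: "x0 \<le> X" "X \<le> B"
    and f[measurable]: "f \<in> borel_measurable borel"
  shows "(LINT x:{X<..B}|M. f x) = (LINT x:{X..B}|lborel. f x * g x)"
proof -
  have B: "x0 \<le> B" using X by simp
  have "set_integrable lborel {x0..B} g" using ac B by (auto simp: abs_cont_from_with_density_def)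
  then have "set_integrable lborel {x0<..B} g" by (rule set_integrable_subset) auto
  then have gm[measurable]: "(\<lambda>x. indicator {x0<..B} x * g x) \<in> borel_measurable borel"
    by (auto simp: set_integrable_def dest: borel_measurable_integrable)
  let ?f = "\<lambda>x. indicator {X<..B} x * f x"
  have "(LINT x:{X<..B}|M. f x) = (LINT x|M. indicator {x0<..B} x *\<^sub>R ?f x)"
    unfolding set_lebesgue_integral_def using X
    by (intro Bochner_Integration.integral_cong) (auto simp: indicator_def)
  also have "\<dots> = (LINT x|density M (\<lambda>x. ennreal (indicator {x0<..B} x)). ?f x)"
    by (intro integral_density[symmetric]) auto
  also have "\<dots> = (LINT x|density lborel (\<lambda>x. ennreal (indicator {x0<..B} x * g x)). ?f x)"
    by (simp only: cdf_density_restrict_eq[OF ac g0 B])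
  also have "\<dots> = (LINT x|lborel. (indicator {x0<..B} x * g x) *\<^sub>R ?f x)"
  proof (rule integral_density)
    show "AE x in lborel. 0 \<le> indicator {x0<..B} x * g x"
      using g0 by (intro AE_I2) (auto simp: indicator_def)
  qed (use gm in simp_all)
  also have "\<dots> = (LINT x:{X..B}|lborel. f x * g x)"
    unfolding set_lebesgue_integral_def
  proof (rule integral_cong_AE)
    show "AE x in lborel. (indicator {x0<..B} x * g x) *\<^sub>R ?f x = indicator {X..B} x *\<^sub>R (f x * g x)"
      using AE_lborel_singleton[of X] by eventually_elim (use X in \<open>auto simp: indicator_def\<close>)
    have "set_integrable lborel {X..B} g"
      by (rule set_integrable_subset[of _ "{x0..B}"]) (use ac B X in \<open>auto simp: abs_cont_from_with_density_def\<close>)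
    then have "(\<lambda>x. f x * (indicator {X..B} x *\<^sub>R g x)) \<in> borel_measurable lborel"
      by (intro borel_measurable_times) (auto simp: set_integrable_def dest: borel_measurable_integrable)
    then show "(\<lambda>x. indicator {X..B} x *\<^sub>R (f x * g x)) \<in> borel_measurable lborel"
      by (simp add: mult_ac)
    show "(\<lambda>x. (indicator {x0<..B} x * g x) *\<^sub>R ?f x) \<in> borel_measurable lborel"
      by measurable
  qed
  finally show ?thesis .
qed

lemma (in real_distribution) moment_le_if_truncated_le:
  assumes nonneg: "AE x in M. 0 \<le> x" and int: "integrable M (\<lambda>x. x ^ k)"
    and X: "0 \<le> X" and trunc: "\<And>B. X \<le> B \<Longrightarrow> (LINT x:{X<..B}|M. x ^ k) \<le> D"
  shows "(LINT x|M. x ^ k) \<le> X ^ k + D"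
proof (rule LIMSEQ_le_const2)
  show "(\<lambda>n. LINT x|M. indicator {..real n} x * x ^ k) \<longlonglongrightarrow> (LINT x|M. x ^ k)"
  proof (rule integral_dominated_convergence)
    show "integrable M (\<lambda>x. \<bar>x ^ k\<bar>)" using int by (rule integrable_abs)
    show "AE x in M. (\<lambda>n. indicator {..real n} x * x ^ k) \<longlonglongrightarrow> x ^ k"
    proof (intro AE_I2 tendsto_eventually)
      fix x :: real
      obtain N where "x \<le> real N" using real_arch_simple by blast
      then show "\<forall>\<^sub>F n in sequentially. indicator {..real n} x * x ^ k = x ^ k"
        by (intro eventually_sequentiallyI[of N]) (auto simp: indicator_def)
    qed
  qed (auto simp: indicator_def)
  obtain N where N: "X \<le> real N" using real_arch_simple by blast
  have "(LINT x|M. indicator {..real n} x * x ^ k) \<le> X ^ k + D" if "N \<le> n" for n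
  proof -
    have Xn: "X \<le> real n" using N that by linarith
    have int_ind: "integrable M (\<lambda>x. indicator A x * x ^ k)" if "A \<in> sets borel" for A
      using integrable_mult_indicator[OF _ int, of A] that by simp
    have "(LINT x|M. indicator {..real n} x * x ^ k) \<le> (LINT x|M. X ^ k + indicator {X<..real n} x * x ^ k)"
    proof (rule integral_mono_AE)
      show "AE x in M. indicator {..real n} x * x ^ k \<le> X ^ k + indicator {X<..real n} x * x ^ k"
        using nonneg by eventually_elim (use X in \<open>auto simp: indicator_def power_mono\<close>)
    qed (auto intro!: int_ind Bochner_Integration.integrable_add)
    also have "\<dots> = X ^ k + (LINT x:{X<..real n}|M. x ^ k)"
    proof -
      have "(LINT x|M. X ^ k) = X ^ k" using prob_space by simp
      then show ?thesis
        by (subst Bochner_Integration.integral_add) (auto simp: int_ind set_lebesgue_integral_def)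
    qed
    also have "\<dots> \<le> X ^ k + D" using trunc[OF Xn] by simp
    finally show ?thesis .
  qed
  then show "\<exists>N. \<forall>n\<ge>N. (LINT x|M. indicator {..real n} x * x ^ k) \<le> X ^ k + D" by blast
qed

section \<open>Logarithmic steps and moment growth\<close>

definition log_step :: "real \<Rightarrow> real \<Rightarrow> real \<Rightarrow> real" where
  "log_step a \<alpha> x = a * (ln x) powr \<alpha> / ln (ln x)"

text \<open>
The derivative of \<open>log_step\<close>, arranged so that \<open>(ln x) powr (\<alpha> - 1) \<le> 1\<close> can be split off.
\<close>

definition log_step_deriv :: "real \<Rightarrow> real \<Rightarrow> real \<Rightarrow> real" where
  "log_step_deriv a \<alpha> x = a * (ln x) powr (\<alpha> - 1) / x * ((\<alpha> * ln (ln x) - 1) / (ln (ln x))\<^sup>2)"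

text \<open>
Beyond \<open>exp (exp 1)\<close> the iterated logarithm is at least one. There, uniformly in the exponent
\<open>\<alpha>\<close>, the step is at most \<open>a ln x\<close> and its derivative is \<open>O(1 / x)\<close>.
\<close>

context
  fixes a \<alpha> x :: real
  assumes a: "0 < a" and \<alpha>: "0 \<le> \<alpha>" "\<alpha> \<le> 1" and x: "exp (exp 1) \<le> x"
begin

lemma iterated_ln_bounds: "0 < x" "1 < x" "1 \<le> ln x" "1 \<le> ln (ln x)"
proof -
  show "0 < x" using x by (rule less_le_trans[rotated]) simp
  then have "exp 1 \<le> ln x" using x by (simp add: ln_ge_iff)
  moreover have "1 \<le> exp (1 :: real)" by simp
  ultimately show "1 \<le> ln x" by linarith
  then show "1 < x" using ln_le_minus_one[OF \<open>0 < x\<close>] by linarith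
  show "1 \<le> ln (ln x)" using \<open>1 \<le> ln x\<close> \<open>exp 1 \<le> ln x\<close> by (simp add: ln_ge_iff)
qed

lemma log_step_nonneg: "0 \<le> log_step a \<alpha> x"
  using iterated_ln_bounds a by (simp add: log_step_def)

lemma log_step_le: "log_step a \<alpha> x \<le> a * ln x"
proof -
  have "(ln x) powr \<alpha> \<le> ln x powr 1"
    using iterated_ln_bounds \<alpha> by (intro powr_mono) auto
  then have "a * (ln x) powr \<alpha> / ln (ln x) \<le> a * ln x / 1"
    using iterated_ln_bounds a by (intro frac_le mult_left_mono) auto
  then show ?thesis by (simp add: log_step_def)
qed

lemma has_derivative_log_step: "(log_step a \<alpha> has_real_derivative log_step_deriv a \<alpha> x) (at x)"
proof -
  note L = iterated_ln_bounds
  have dln: "(ln has_real_derivative 1 / x) (at x)" using L by (intro DERIV_ln_divide)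
  have pw: "((\<lambda>x. (ln x) powr \<alpha>) has_real_derivative \<alpha> * (ln x) powr (\<alpha> - 1) * (1 / x)) (at x)"
    using L by (intro DERIV_chain2[OF has_real_derivative_powr dln]) auto
  have ll: "((\<lambda>x. ln (ln x)) has_real_derivative 1 / ln x * (1 / x)) (at x)"
    using L by (intro DERIV_chain2[OF DERIV_ln_divide dln]) auto
  have "(log_step a \<alpha> has_real_derivative
      ((a * (\<alpha> * (ln x) powr (\<alpha> - 1) * (1 / x))) * ln (ln x) - (a * (ln x) powr \<alpha>) * (1 / ln x * (1 / x)))
      / (ln (ln x) * ln (ln x))) (at x)"
    unfolding log_step_def using L by (intro DERIV_divide DERIV_cmult pw ll) auto
  moreover have "(ln x) powr \<alpha> = (ln x) powr (\<alpha> - 1) * ln x"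
    using L by (simp add: powr_diff)
  ultimately show ?thesis
    using L by (simp add: log_step_deriv_def power2_eq_square field_simps)
qed

lemma abs_log_step_deriv_le: "\<bar>log_step_deriv a \<alpha> x\<bar> \<le> 2 * a / x"
proof -
  note L = iterated_ln_bounds
  have "(ln x) powr (\<alpha> - 1) \<le> (ln x) powr 0" using L \<alpha> by (intro powr_mono) auto
  then have pw: "(ln x) powr (\<alpha> - 1) \<le> 1" using L by simp
  have "\<bar>\<alpha> * ln (ln x) - 1\<bar> \<le> ln (ln x) + 1"
  proof -
    have "\<alpha> * ln (ln x) \<le> 1 * ln (ln x)" using L \<alpha> by (intro mult_right_mono) auto
    moreover have "0 \<le> \<alpha> * ln (ln x)" using L \<alpha> by (intro mult_nonneg_nonneg) auto
    ultimately show ?thesis using L by linarith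
  qed
  also have "\<dots> \<le> 2 * (ln (ln x))\<^sup>2"
    using L self_le_power[of "ln (ln x)" 2] by simp
  finally have "\<bar>\<alpha> * ln (ln x) - 1\<bar> / (ln (ln x))\<^sup>2 \<le> 2"
    using L by (simp add: divide_le_eq)
  with pw have "(a * (ln x) powr (\<alpha> - 1) / x) * (\<bar>\<alpha> * ln (ln x) - 1\<bar> / (ln (ln x))\<^sup>2) \<le> (a * 1 / x) * 2"
    using L a by (intro mult_mono divide_right_mono mult_left_mono) auto
  then show ?thesis
    using L a by (simp add: log_step_deriv_def abs_mult abs_divide mult_ac)
qed

end

lemma continuous_on_log_step_deriv: "continuous_on {exp (exp 1)..} (log_step_deriv a \<alpha>)"
proof -
  have "x \<noteq> 0 \<and> ln x \<noteq> 0 \<and> ln (ln x) \<noteq> 0" if "x \<in> {exp (exp 1)..}" for x :: real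
    using iterated_ln_bounds[of 1 1 x] that by auto
  then show ?thesis
    unfolding log_step_deriv_def by (intro continuous_intros) auto
qed

lemma limsup_ratio_less_one:
  fixes r :: "real \<Rightarrow> real"
  assumes lim: "Limsup at_top (\<lambda>x. ereal (r x)) < 1" and pos: "\<And>x. x0 \<le> x \<Longrightarrow> 0 < r x"
  obtains q R where "0 < q" "q < 1" "\<And>x. R \<le> x \<Longrightarrow> r x \<le> q"
proof -
  obtain q where q: "Limsup at_top (\<lambda>x. ereal (r x)) < ereal q" "ereal q < 1"
    using ereal_dense2[OF lim] by blast
  have "\<forall>\<^sub>F x in at_top. r x \<le> max q (1 / 2)"
    using Limsup_lessD[OF q(1)] by eventually_elim auto
  then obtain R where "\<And>x. R \<le> x \<Longrightarrow> r x \<le> max q (1 / 2)"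
    by (auto simp: eventually_at_top_linorder)
  then show ?thesis using q(2) by (intro that[of "max q (1 / 2)" R]) auto
qed

text \<open>
At the scale \<open>X = C log_weight n\<close> this makes \<open>n ln X / X\<close> at most \<open>(ln C + 2) / C\<close>, uniformly in \<open>n\<close>,
and hence as small as desired when \<open>C\<close> is large.
\<close>

lemma ln_scaled_log_weight_le:
  assumes C: "1 \<le> C"
  shows "real n * ln (C * log_weight n) \<le> (ln C + 2) * log_weight n"
proof -
  let ?l = "ln (real (n + 3))"
  have l: "1 < ?l" by (rule one_less_ln)
  have "ln (C * log_weight n) = ln C + ln (real (n + 1)) + ln ?l"
    using C l by (simp add: log_weight_def ln_mult)
  also have "\<dots> \<le> ln C * ?l + ?l + ?l"
  proof (intro add_mono)
    show "ln C \<le> ln C * ?l" using C l by (simp add: mult_le_cancel_left1)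
    show "ln (real (n + 1)) \<le> ?l" by simp
    show "ln ?l \<le> ?l" using l ln_le_minus_one[of ?l] by linarith
  qed
  finally have "ln (C * log_weight n) \<le> (ln C + 2) * ?l" by (simp add: algebra_simps)
  moreover have "0 \<le> ln (C * log_weight n)"
    using mult_mono[OF C log_weight_ge_1[of n]] C by simp
  ultimately have "real n * ln (C * log_weight n) \<le> real (n + 1) * ((ln C + 2) * ?l)"
    by (intro mult_mono) auto
  then show ?thesis by (simp add: log_weight_def mult_ac)
qed

text \<open>
A step of logarithmic length changes the \<open>k\<close>-th power by the factor \<open>exp (k s / x)\<close> at most, and \<open>ln x / x\<close>
decreases, so it suffices to control the smallest point \<open>X\<close>.
\<close>

lemma power_add_log_step_le:
  assumes a: "0 < a" and x: "exp 1 \<le> X" "X \<le> x"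
    and s: "0 \<le> s" "s \<le> a * ln x" and small: "real k * (a * ln X / X) \<le> \<eta>"
  shows "(x + s) ^ k \<le> exp \<eta> * x ^ k"
proof -
  have "(0::real) < exp 1" by simp
  then have X: "0 < X" "0 < x" using x by linarith+
  have "s / x \<le> a * (ln x / x)" using s X by (simp add: divide_right_mono)
  also have "\<dots> \<le> a * (ln X / X)" using a x by (intro mult_left_mono ln_x_over_x_mono) auto
  finally have "real k * (s / x) \<le> real k * (a * ln X / X)" by (intro mult_left_mono) auto
  with small have small': "real k * (s / x) \<le> \<eta>" by linarith
  have "(x + s) ^ k = x ^ k * (1 + s / x) ^ k"
    using X by (simp add: power_mult_distrib[symmetric] algebra_simps)
  also have "\<dots> \<le> x ^ k * exp (s / x) ^ k"
    using X s by (intro mult_left_mono power_mono) auto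
  also have "\<dots> = x ^ k * exp (real k * (s / x))" by (simp only: exp_of_nat_mult)
  also have "\<dots> \<le> x ^ k * exp \<eta>" using X small' by (intro mult_left_mono) auto
  finally show ?thesis by (simp add: mult.commute)
qed

lemma exists_large_scale:
  fixes a \<eta> R :: real
  assumes "0 < \<eta>"
  obtains C where "R \<le> C" "1 \<le> C" "2 * a * (ln C + 2) / C \<le> \<eta>"
proof -
  have "((\<lambda>C. 2 * a * (ln C / C + 2 / C)) \<longlongrightarrow> 2 * a * (0 + 0)) at_top"
    by (intro tendsto_intros ln_x_over_x_tendsto_0 tendsto_divide_0[OF tendsto_const] filterlim_at_top_imp_at_infinity filterlim_ident)
  then have "((\<lambda>C. 2 * a * (ln C + 2) / C) \<longlongrightarrow> 0) at_top"
    by (simp add: add_divide_distrib distrib_left)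
  then have "\<forall>\<^sub>F C in at_top. 2 * a * (ln C + 2) / C < \<eta>"
    using assms by (rule order_tendstoD(2))
  with eventually_ge_at_top[of R] eventually_ge_at_top[of 1]
  have "\<forall>\<^sub>F C in at_top. R \<le> C \<and> 1 \<le> C \<and> 2 * a * (ln C + 2) / C \<le> \<eta>"
    by eventually_elim auto
  then show ?thesis using that eventually_happens'[OF trivial_limit_at_top_linorder] by blast
qed

text \<open>
The moment of order \<open>2 n\<close> is split at \<open>X = C log_weight n\<close>. Beyond this point, with \<open>C\<close> large,
a step \<open>x \<mapsto> T x\<close> changes \<open>x ^ (2 n)\<close> by a factor close to one only, so that the tail beyond \<open>X\<close> is
controlled by the decay of the density. Both parts are then at most a constant times \<open>X ^ (2 n)\<close>.
\<close>

lemma (in real_distribution) even_moment_growth: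
  assumes nonneg: "AE x in M. 0 \<le> x" and moments: "\<And>n. integrable M (\<lambda>x. x ^ n)"
    and ac: "abs_cont_from_with_density (cdf M) x0 g" and g0: "\<And>x. x0 \<le> x \<Longrightarrow> 0 < g x"
    and a: "0 < a" and \<alpha>: "0 \<le> \<alpha>" "\<alpha> \<le> 1"
    and lim: "Limsup at_top (\<lambda>x. ereal (g (x + log_step a \<alpha> x) / g x)) < 1"
  obtains A C where "1 \<le> A" "1 \<le> C" "\<And>n. (LINT x|M. x ^ (2 * n)) \<le> A * (C * log_weight n) ^ (2 * n)"
proof -
  define T where "T = (\<lambda>x. x + log_step a \<alpha> x)"
  define T' where "T' = (\<lambda>x. 1 + log_step_deriv a \<alpha> x)"
  define R0 where "R0 = max x0 (exp (exp 1))"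
  have R0: "x0 \<le> R0" "exp (exp 1) \<le> R0" by (auto simp: R0_def)
  have "0 < g (T x) / g x" if "R0 \<le> x" for x
    using g0[of x] g0[of "T x"] log_step_nonneg[OF a \<alpha>, of x] that R0 by (auto simp: T_def)
  then obtain q R1 where q: "0 < q" "q < 1" and ratio: "\<And>x. R1 \<le> x \<Longrightarrow> g (T x) / g x \<le> q"
    using limsup_ratio_less_one[OF lim, of R0] unfolding T_def by metis
  \<comment> \<open>The losses from the derivative and from the power are each kept below \<open>exp \<eta>\<close>, so a third of \<open>- ln q\<close> still leaves a contraction.\<close>
  define \<eta> where "\<eta> = - ln q / 3"
  have \<eta>: "0 < \<eta>" using q by (simp add: \<eta>_def)
  have "q = exp (- 3 * \<eta>)" using q by (simp add: \<eta>_def)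
  then have "q * (exp \<eta>)\<^sup>2 = exp (- 3 * \<eta> + 2 * \<eta>)"
    by (simp only: exp_add exp_double[symmetric])
  then have contr: "q * (exp \<eta>)\<^sup>2 < 1" using \<eta> by simp
  obtain C where C: "max (max R0 R1) (2 * a) \<le> C" "1 \<le> C" and C_small: "2 * a * (ln C + 2) / C \<le> \<eta>"
    using exists_large_scale[OF \<eta>] by blast
  define D where "D = exp \<eta> / (1 - q * (exp \<eta>)\<^sup>2)"
  have "(LINT x|M. x ^ (2 * n)) \<le> (1 + D) * (C * log_weight n) ^ (2 * n)" for n
  proof -
    define X where "X = C * log_weight n"
    have CX: "C \<le> X" using C log_weight_ge_1[of n] by (simp add: X_def mult_le_cancel_left1)
    then have X: "R0 \<le> X" "R1 \<le> X" "1 \<le> X" using C by auto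
    have big: "exp (exp 1) \<le> x" "x0 \<le> x" "R1 \<le> x" "1 \<le> x" if "X \<le> x" for x using that X R0 by auto
    have "exp 1 \<le> exp (exp (1 :: real))" by simp
    then have e_X: "exp 1 \<le> X" using big(1)[of X] by linarith
    have scale: "real (2 * n) * (a * ln X / X) \<le> \<eta>"
    proof -
      have "real n * ln X / X \<le> (ln C + 2) * log_weight n / X"
        using ln_scaled_log_weight_le[OF C(2), of n] X by (intro divide_right_mono) (auto simp: X_def)
      also have "\<dots> = (ln C + 2) / C" using log_weight_pos[of n] by (simp add: X_def)
      finally have "2 * a * (real n * ln X / X) \<le> 2 * a * ((ln C + 2) / C)"
        using a by (intro mult_left_mono) auto
      with C_small show ?thesis by (simp add: mult_ac)
    qed
    have slope: "2 * a / x \<le> 1" "2 * a / x \<le> \<eta>" if "X \<le> x" for x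
    proof -
      have Cx: "0 < C" "C \<le> x" using C CX that by auto
      then have "2 * a / x \<le> 2 * a / C" using a by (intro divide_left_mono) auto
      moreover have "2 * a / C \<le> 1" using C Cx by simp
      moreover have "2 * a / C \<le> 2 * a * (ln C + 2) / C"
        using C Cx a by (intro divide_right_mono) (auto simp: mult_le_cancel_left1)
      ultimately show "2 * a / x \<le> 1" "2 * a / x \<le> \<eta>" using C_small by linarith+
    qed
    have trunc: "(LINT x:{X<..B}|M. x ^ (2 * n)) \<le> D * X ^ (2 * n)" if B: "X \<le> B" for B
    proof -
      have g_nonneg: "0 \<le> g x" if "x0 \<le> x" for x using g0[OF that] by simp
      have eq: "(LINT x:{X<..v}|M. f x) = (LINT x:{X..v}|lborel. f x * g x)"
        if "X \<le> v" "f \<in> borel_measurable borel" for v and f :: "real \<Rightarrow> real"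
        using truncated_expectation_eq[OF ac g_nonneg _ that] big(2)[of X] by simp
      have "(LINT x:{X<..B}|M. x ^ (2 * n)) = (LINT x:{X..B}|lborel. x ^ (2 * n) * g x)"
        using B by (rule eq) simp
      also have "\<dots> \<le> D * X ^ (2 * n)"
        unfolding D_def
      proof (rule truncated_density_moment_le[where T = T and T' = T'])
        show "0 \<le> X" "X \<le> B" using X B by auto
        show "set_integrable lborel {X..v} g" for v
        proof (cases "x0 \<le> v")
          case True
          then have "set_integrable lborel {x0..v} g" using ac by (simp add: abs_cont_from_with_density_def)
          then show ?thesis by (rule set_integrable_subset) (use big(2)[of X] in auto)
        qed (use big(2)[of X] in \<open>simp add: set_integrable_def\<close>)
        show "(LINT x:{X..v}|lborel. g x) \<le> 1" if "X \<le> v" for v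
          using eq[OF that, of "\<lambda>_. 1"] prob_le_1[of "{X<..v}"]
          by (simp add: set_lebesgue_integral_def)
        show "continuous_on {X..} T'"
          unfolding T'_def
          by (intro continuous_intros continuous_on_subset[OF continuous_on_log_step_deriv]) (use big in auto)
        show "q * (exp \<eta>)\<^sup>2 < 1" by (rule contr)
        fix x assume x: "X \<le> x"
        note big_x = big[OF x]
        show "0 \<le> g x" using g_nonneg big_x by simp
        show "(T has_real_derivative T' x) (at x)"
          unfolding T_def T'_def
          by (intro DERIV_add DERIV_ident has_derivative_log_step[OF a \<alpha> big_x(1)])
        show "0 \<le> T' x" "T' x \<le> exp \<eta>"
          using abs_log_step_deriv_le[OF a \<alpha> big_x(1)] slope[OF x] exp_ge_add_one_self[of \<eta>]
          unfolding T'_def by linarith+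
        show "x \<le> T x" using log_step_nonneg[OF a \<alpha> big_x(1)] by (simp add: T_def)
        show "T x ^ (2 * n) \<le> exp \<eta> * x ^ (2 * n)"
          unfolding T_def
          by (intro power_add_log_step_le[OF a e_X x] log_step_nonneg[OF a \<alpha> big_x(1)]
              log_step_le[OF a \<alpha> big_x(1)] scale)
        show "g (T x) \<le> q * g x"
          using ratio[OF big_x(3)] g0[OF big_x(2)] by (simp add: divide_le_eq)
      qed
      finally show ?thesis .
    qed
    have "(LINT x|M. x ^ (2 * n)) \<le> X ^ (2 * n) + D * X ^ (2 * n)"
      using X by (intro moment_le_if_truncated_le nonneg moments trunc) auto
    then show ?thesis by (simp add: X_def distrib_right)
  qed
  moreover have "0 \<le> D" using contr by (simp add: D_def)
  ultimately show ?thesis using C by (intro that[of "1 + D" C]) auto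
qed

section \<open>Determinacy\<close>

text \<open>
The ratios \<open>c i\<close> for Carleman's criterion are multiples of \<open>log_weight i\<close>; the factor \<open>e\<^sup>2\<close> pays for
the passage from the power to the product.
\<close>

lemma M_det_dist_if_log_growth:
  assumes \<mu>: "nonneg_dist_finite_moments \<mu>" and A: "0 \<le> A" and C: "0 < C"
    and growth: "\<And>n. (LINT x|\<mu>. x ^ n) \<le> A * (C * log_weight n) ^ (2 * n)"
  shows "M_det_dist \<mu>"
proof (rule carleman_stieltjes[OF \<mu>])
  let ?c = "\<lambda>n. C * exp 2 * log_weight n"
  show "0 < ?c n" for n using C log_weight_pos by simp
  show "mono ?c" using C by (intro monoI mult_left_mono monoD[OF mono_log_weight]) auto
  show "\<not> summable (\<lambda>n. 1 / ?c n)"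
  proof
    assume "summable (\<lambda>n. 1 / ?c n)"
    then have "summable (\<lambda>n. C * exp 2 * (1 / ?c n))" by (rule summable_mult)
    with C not_summable_inverse_log_weight show False by simp
  qed
  show "(LINT x|\<mu>. x ^ n) \<le> A * (\<Prod>i<n. ?c i)\<^sup>2" for n
  proof -
    have "(C * log_weight n) ^ n \<le> C ^ n * (exp 2 ^ n * (\<Prod>i<n. log_weight i))"
      unfolding power_mult_distrib using C by (intro mult_left_mono log_weight_power_le_prod) auto
    also have "\<dots> = (\<Prod>i<n. ?c i)" by (simp add: prod.distrib power_mult_distrib)
    finally have "((C * log_weight n) ^ n)\<^sup>2 \<le> (\<Prod>i<n. ?c i)\<^sup>2"
      using C by (intro power_mono) (auto simp: less_imp_le[OF log_weight_pos])
    then have "A * (C * log_weight n) ^ (2 * n) \<le> A * (\<Prod>i<n. ?c i)\<^sup>2"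
      using A by (intro mult_left_mono) (auto simp: power_mult[symmetric] mult.commute)
    with growth[of n] show ?thesis by (rule order_trans)
  qed
qed

theorem corollary5:
  fixes M :: "'a measure" and Y :: "'a \<Rightarrow> real" and G g :: "real \<Rightarrow> real"
    and a \<alpha> x0 :: real
  assumes "a > 0" and "0 \<le> \<alpha>" and "\<alpha> \<le> 1"
    and "prob_space M" and "Y \<in> borel_measurable M"
    and "\<forall>\<omega>\<in>space M. 0 \<le> Y \<omega>"
    and "\<forall>n\<ge>1. integrable M (\<lambda>\<omega>. Y \<omega> ^ n)"
    and "G = cdf (distr M borel Y)"
    and "x0 > exp 1"
    and "abs_cont_from_with_density G x0 g"
    and "\<forall>x\<ge>x0. g x > 0"
    and "Limsup at_top (\<lambda>x. ereal (g (x + a * (ln x) powr \<alpha> / ln (ln x)) / g x)) < 1"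
  shows "M_det M Y \<and> M_det M (\<lambda>\<omega>. (Y \<omega>)\<^sup>2)"
proof -
  interpret prob_space M by fact
  note [measurable] = \<open>Y \<in> borel_measurable M\<close>
  interpret law: real_distribution "distr M borel Y" by (rule real_distribution_distr) measurable
  have moments: "integrable M (\<lambda>\<omega>. Y \<omega> ^ n)" for n
    using assms(7) by (cases "n = 0") auto
  have nonneg: "AE x in distr M borel Y. 0 \<le> x"
    using assms(6) by (subst AE_distr_iff) auto
  obtain A C where A: "1 \<le> A" and C: "1 \<le> C"
    and growth: "\<And>n. (LINT x|distr M borel Y. x ^ (2 * n)) \<le> A * (C * log_weight n) ^ (2 * n)"
    using law.even_moment_growth[where g = g, OF nonneg _ _ _ assms(1-3)] assms(8,10-12) moments
    by (auto simp: integrable_distr_eq log_step_def)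
  have growth: "(LINT \<omega>|M. Y \<omega> ^ (2 * n)) \<le> A * (C * log_weight n) ^ (2 * n)" for n
    using growth[of n] by (simp add: integral_distr)
  have "M_det M (\<lambda>\<omega>. (Y \<omega>)\<^sup>2)"
    unfolding M_det_def
  proof (rule M_det_dist_if_log_growth)
    show "nonneg_dist_finite_moments (distr M borel (\<lambda>\<omega>. (Y \<omega>)\<^sup>2))"
      unfolding nonneg_dist_finite_moments_def using moments
      by (auto simp: AE_distr_iff integrable_distr_eq power_mult[symmetric])
    show "(LINT x|distr M borel (\<lambda>\<omega>. (Y \<omega>)\<^sup>2). x ^ n) \<le> A * (C * log_weight n) ^ (2 * n)" for n
      using growth[of n] by (simp add: integral_distr power_mult[symmetric])
  qed (use A C in auto)
  moreover have "M_det M Y"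
    unfolding M_det_def
  proof (rule M_det_dist_if_log_growth)
    show "nonneg_dist_finite_moments (distr M borel Y)"
      unfolding nonneg_dist_finite_moments_def using moments nonneg
      by (auto simp: integrable_distr_eq)
    show "(LINT x|distr M borel Y. x ^ n) \<le> (A + 1) * (C * log_weight n) ^ (2 * n)" for n
    proof -
      have "(LINT x|distr M borel Y. x ^ n) = (LINT \<omega>|M. Y \<omega> ^ n)" by (simp add: integral_distr)
      also have "\<dots> \<le> (LINT \<omega>|M. Y \<omega> ^ (2 * n) + 1)"
      proof (rule integral_mono)
        \<comment> \<open>The law of \<open>Y\<close> thus satisfies, up to the constant, the same moment bound as that of \<open>Y\<^sup>2\<close>.\<close>
        show "Y \<omega> ^ n \<le> Y \<omega> ^ (2 * n) + 1" for \<omega>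
        proof -
          have "0 \<le> (Y \<omega> ^ n - 1 / 2)\<^sup>2" by simp
          moreover have "Y \<omega> ^ (2 * n) = (Y \<omega> ^ n)\<^sup>2"
            by (simp add: power_mult[symmetric] mult.commute)
          ultimately show ?thesis by (simp add: power2_diff power_divide)
        qed
      qed (use moments in auto)
      also have "\<dots> = (LINT \<omega>|M. Y \<omega> ^ (2 * n)) + 1"
        using moments prob_space by simp
      also have "\<dots> \<le> A * (C * log_weight n) ^ (2 * n) + 1 * (C * log_weight n) ^ (2 * n)"
        using growth[of n] mult_mono[OF C log_weight_ge_1[of n]] C
        by (intro add_mono) (auto intro!: one_le_power)
      finally show ?thesis by (simp only: distrib_right)
    qed
  qed (use A C in auto)
  ultimately show ?thesis by simp
qed

end
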